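(* Let $X$ be a locally path-connected compact Hausdorff space and let $D\subset X$ be a closed totally disconnected subspace. Endow $X$ with the externology $\varepsilon(X)=\{U : D\subset U,\ U \text{ open in } X\}$. Then the exterior space $X$ is $\check C_0$-complete.
   Context: Exterior spaces: an exterior space is a topological space $X$ together with a nonempty family $\varepsilon(X)$ of open subsets (an externology; its members are called exterior open subsets) closed under finite intersections and such that if $E\in\varepsilon(X)$, $U$ is open and $E\subset U$, then $U\in\varepsilon(X)$. A map between exterior spaces is exterior if it is continuous and preimages of exterior open subsets are exterior open. $\mathbf E$ is the category of exterior spaces and exterior maps. Limit and end spaces: for a space $Y$, $\pi_0(Y)$ is the set of path-components with the quotient topology of $q_0\colon Y\to\pi_0(Y)$. $L(X)=\bigcap_{E\in\varepsilon(X)}E$ (subspace topology); $\check\pi_0(X)=\lim_{E\in\varepsilon(X)}\pi_0(E)$ (inverse limit topology), with projections $\eta_{0,E}\colon\check\pi_0(X)\to\pi_0(E)$; $e_0\colon L(X)\to\check\pi_0(X)$ sends $x$ to the family of path-components of $x$ in the sets $E$. Completion: $\check C_0(X)$ has underlying set the push-out $X\cup_{L(X)}\check\pi_0(X)$ of the inclusion $L(X)\to X$ and $e_0$, with canonical maps $p_0\colon X\to\check C_0(X)$, $\operatorname{in}_0\colon\check\pi_0(X)\to\check C_0(X)$. A subset $W$ is open iff (i) $p_0^{-1}(W)$ and $\operatorname{in}_0^{-1}(W)$ are open, and (ii) for each $a\in\operatorname{in}_0^{-1}(W)$ there are $E\in\varepsilon(X)$ and an open $G\subset\pi_0(E)$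 with $a\in\eta_{0,E}^{-1}(G)\subset\operatorname{in}_0^{-1}(W)$ and $q_0^{-1}(G)\subset p_0^{-1}(W)$. Its externology is $\{W_0(E): E\in\varepsilon(X)\}$ with $W_0(E)=p_0(E)\cup\operatorname{in}_0(\check\pi_0(X))$. $X$ is $\check C_0$-complete if $p_0\colon X\to\check C_0(X)$ is an isomorphism in $\mathbf E$. *)

theory Defs
  imports "HOL-Analysis.Analysis"
begin

section \<open>Exterior spaces\<close>

definition exterior_space :: "'a topology \<Rightarrow> 'a set set \<Rightarrow> bool" where
  "exterior_space X \<epsilon> \<longleftrightarrow>
     \<epsilon> \<noteq> {} \<and> (\<forall>E\<in>\<epsilon>. openin X E) \<and>
     (\<forall>E\<in>\<epsilon>. \<forall>F\<in>\<epsilon>. E \<inter> F \<in> \<epsilon>) \<and>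
     (\<forall>E\<in>\<epsilon>. \<forall>U. openin X U \<and> E \<subseteq> U \<longrightarrow> U \<in> \<epsilon>)"

definition exterior_map ::
    "'a topology \<Rightarrow> 'a set set \<Rightarrow> 'b topology \<Rightarrow> 'b set set \<Rightarrow> ('a \<Rightarrow> 'b) \<Rightarrow> bool" where
  "exterior_map X \<epsilon> Y \<delta> f \<longleftrightarrow>
     exterior_space X \<epsilon> \<and> exterior_space Y \<delta> \<and> continuous_map X Y f \<and>
     (\<forall>E\<in>\<delta>. {x \<in> topspace X. f x \<in> E} \<in> \<epsilon>)"

definition exterior_isomorphism ::
    "'a topology \<Rightarrow> 'a set set \<Rightarrow> 'b topology \<Rightarrow> 'b set set \<Rightarrow> ('a \<Rightarrow> 'b) \<Rightarrow> bool" where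
  "exterior_isomorphism X \<epsilon> Y \<delta> f \<longleftrightarrow>
     exterior_map X \<epsilon> Y \<delta> f \<and>
     (\<exists>g. exterior_map Y \<delta> X \<epsilon> g \<and>
          (\<forall>x\<in>topspace X. g (f x) = x) \<and> (\<forall>y\<in>topspace Y. f (g y) = y))"

section \<open>Path components, limit space and end space\<close>

text \<open>The quotient map from \<open>Y\<close> to its set of path components is
  \<^term>\<open>path_component_of_set Y\<close>.\<close>

definition pi0 :: "'a topology \<Rightarrow> 'a set topology" where
  "pi0 Y = topology (\<lambda>G. G \<subseteq> path_components_of Y \<and>
     openin Y {y \<in> topspace Y. path_component_of_set Y y \<in> G})"

text \<open>The map on path components induced by the inclusion of a subspace into \<open>Y\<close>:
  all points of a path component \<open>C\<close> of the subspace have the same path component in \<open>Y\<close>.\<close>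

definition pi0_incl :: "'a topology \<Rightarrow> 'a set \<Rightarrow> 'a set" where
  "pi0_incl Y C = the_elem (path_component_of_set Y ` C)"

definition limit_set :: "'a set set \<Rightarrow> 'a set" where
  "limit_set \<epsilon> = \<Inter>\<epsilon>"

text \<open>Points of the end space are compatible families \<open>a\<close> indexed by \<open>\<epsilon>\<close> (and
  \<^term>\<open>undefined\<close> outside \<open>\<epsilon>\<close>); the projection at \<open>E\<close> sends \<open>a\<close> to \<open>a E\<close>.\<close>

definition end_space :: "'a topology \<Rightarrow> 'a set set \<Rightarrow> ('a set \<Rightarrow> 'a set) topology" where
  "end_space X \<epsilon> =
     subtopology (product_topology (\<lambda>E. pi0 (subtopology X E)) \<epsilon>)
       {a. \<forall>E\<in>\<epsilon>. \<forall>F\<in>\<epsilon>. E \<subseteq> F \<longrightarrow> pi0_incl (subtopology X F) (a E) = a F}"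

definition e0 :: "'a topology \<Rightarrow> 'a set set \<Rightarrow> 'a \<Rightarrow> ('a set \<Rightarrow> 'a set)" where
  "e0 X \<epsilon> x = (\<lambda>E\<in>\<epsilon>. path_component_of_set (subtopology X E) x)"

section \<open>The completion\<close>

text \<open>The push-out of sets is the quotient of the disjoint union by the equivalence relation
  generated by identifying \<open>x\<close> with \<^term>\<open>e0 X \<epsilon> x\<close> for every \<open>x\<close> in the limit space.\<close>

definition glue ::
    "'a topology \<Rightarrow> 'a set set \<Rightarrow> 'a + ('a set \<Rightarrow> 'a set) \<Rightarrow> 'a + ('a set \<Rightarrow> 'a set) \<Rightarrow> bool" where
  "glue X \<epsilon> u v \<longleftrightarrow> (\<exists>x\<in>limit_set \<epsilon>. u = Inl x \<and> v = Inr (e0 X \<epsilon> x))"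

definition pushout_carrier :: "'a topology \<Rightarrow> 'a set set \<Rightarrow> ('a + ('a set \<Rightarrow> 'a set)) set set" where
  "pushout_carrier X \<epsilon> =
     (topspace X <+> topspace (end_space X \<epsilon>)) // {(u, v). equivclp (glue X \<epsilon>) u v}"

definition p0 :: "'a topology \<Rightarrow> 'a set set \<Rightarrow> 'a \<Rightarrow> ('a + ('a set \<Rightarrow> 'a set)) set" where
  "p0 X \<epsilon> x = {(u, v). equivclp (glue X \<epsilon>) u v} `` {Inl x}"

definition in0 ::
    "'a topology \<Rightarrow> 'a set set \<Rightarrow> ('a set \<Rightarrow> 'a set) \<Rightarrow> ('a + ('a set \<Rightarrow> 'a set)) set" where
  "in0 X \<epsilon> a = {(u, v). equivclp (glue X \<epsilon>) u v} `` {Inr a}"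

definition p0_preimage ::
    "'a topology \<Rightarrow> 'a set set \<Rightarrow> ('a + ('a set \<Rightarrow> 'a set)) set set \<Rightarrow> 'a set" where
  "p0_preimage X \<epsilon> W = {x \<in> topspace X. p0 X \<epsilon> x \<in> W}"

definition in0_preimage ::
    "'a topology \<Rightarrow> 'a set set \<Rightarrow> ('a + ('a set \<Rightarrow> 'a set)) set set \<Rightarrow> ('a set \<Rightarrow> 'a set) set" where
  "in0_preimage X \<epsilon> W = {a \<in> topspace (end_space X \<epsilon>). in0 X \<epsilon> a \<in> W}"

definition C0_open ::
    "'a topology \<Rightarrow> 'a set set \<Rightarrow> ('a + ('a set \<Rightarrow> 'a set)) set set \<Rightarrow> bool" where
  "C0_open X \<epsilon> W \<longleftrightarrow>
     W \<subseteq> pushout_carrier X \<epsilon> \<and>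
     openin X (p0_preimage X \<epsilon> W) \<and>
     openin (end_space X \<epsilon>) (in0_preimage X \<epsilon> W) \<and>
     (\<forall>a\<in>in0_preimage X \<epsilon> W. \<exists>E\<in>\<epsilon>. \<exists>G. openin (pi0 (subtopology X E)) G \<and>
        a \<in> {b \<in> topspace (end_space X \<epsilon>). b E \<in> G} \<and>
        {b \<in> topspace (end_space X \<epsilon>). b E \<in> G} \<subseteq> in0_preimage X \<epsilon> W \<and>
        {x \<in> topspace (subtopology X E). path_component_of_set (subtopology X E) x \<in> G}
          \<subseteq> p0_preimage X \<epsilon> W)"

definition C0 :: "'a topology \<Rightarrow> 'a set set \<Rightarrow> ('a + ('a set \<Rightarrow> 'a set)) set topology" where
  "C0 X \<epsilon> = topology (C0_open X \<epsilon>)"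

definition W0 :: "'a topology \<Rightarrow> 'a set set \<Rightarrow> 'a set \<Rightarrow> ('a + ('a set \<Rightarrow> 'a set)) set set" where
  "W0 X \<epsilon> E = p0 X \<epsilon> ` E \<union> in0 X \<epsilon> ` topspace (end_space X \<epsilon>)"

definition C0_externology ::
    "'a topology \<Rightarrow> 'a set set \<Rightarrow> ('a + ('a set \<Rightarrow> 'a set)) set set set" where
  "C0_externology X \<epsilon> = {W0 X \<epsilon> E | E. E \<in> \<epsilon>}"

definition C0_complete :: "'a topology \<Rightarrow> 'a set set \<Rightarrow> bool" where
  "C0_complete X \<epsilon> \<longleftrightarrow>
     exterior_isomorphism X \<epsilon> (C0 X \<epsilon>) (C0_externology X \<epsilon>) (p0 X \<epsilon>)"

definition totally_disconnected_space :: "'a topology \<Rightarrow> bool" where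
  "totally_disconnected_space Y \<longleftrightarrow> (\<forall>S. connectedin Y S \<longrightarrow> (\<exists>x. S \<subseteq> {x}))"

section \<open>The topologies and the externology above are well defined\<close>

lemma istopology_pi0:
  "istopology (\<lambda>G. G \<subseteq> path_components_of Y \<and>
     openin Y {y \<in> topspace Y. path_component_of_set Y y \<in> G})"
proof -
  have 1: "{y \<in> topspace Y. path_component_of_set Y y \<in> S \<inter> T} =
      {y \<in> topspace Y. path_component_of_set Y y \<in> S} \<inter>
      {y \<in> topspace Y. path_component_of_set Y y \<in> T}" for S T
    by auto
  have 2: "{y \<in> topspace Y. path_component_of_set Y y \<in> \<Union>K} =
      (\<Union>S\<in>K. {y \<in> topspace Y. path_component_of_set Y y \<in> S})" for K
    by auto
  show ?thesis
    unfolding istopology_def 1 2 by (auto intro!: openin_Int openin_Union)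
qed

lemma openin_pi0:
  "openin (pi0 Y) G \<longleftrightarrow> G \<subseteq> path_components_of Y \<and>
     openin Y {y \<in> topspace Y. path_component_of_set Y y \<in> G}"
  unfolding pi0_def topology_inverse'[OF istopology_pi0] by (rule refl)

lemma topspace_pi0: "topspace (pi0 Y) = path_components_of Y"
proof -
  have "{y \<in> topspace Y. path_component_of_set Y y \<in> path_components_of Y} = topspace Y"
    by (auto simp: path_components_of_def)
  then have "openin (pi0 Y) (path_components_of Y)"
    by (simp add: openin_pi0)
  moreover have "topspace (pi0 Y) \<subseteq> path_components_of Y"
    using openin_topspace[of "pi0 Y"] by (simp only: openin_pi0)
  ultimately show ?thesis
    by (intro subset_antisym openin_subset)
qed

lemma pi0_incl_eq:
  assumes "E \<subseteq> F" "x \<in> topspace X" "x \<in> E"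
  shows "pi0_incl (subtopology X F) (path_component_of_set (subtopology X E) x)
       = path_component_of_set (subtopology X F) x"
proof -
  have x: "path_component_of (subtopology X E) x x"
    using assms by (simp add: path_component_of_refl)
  have "path_component_of (subtopology X F) x y"
    if "path_component_of (subtopology X E) x y" for y
    using that assms(1)
    by (rule path_component_of_mono)
  then have *: "path_component_of_set (subtopology X F) y = path_component_of_set (subtopology X F) x"
    if "path_component_of (subtopology X E) x y" for y
    using that by (metis path_component_of_equiv)
  have "path_component_of_set (subtopology X F) ` path_component_of_set (subtopology X E) x
      = (\<lambda>_. path_component_of_set (subtopology X F) x) ` path_component_of_set (subtopology X E) x"
    by (rule image_cong[OF refl]) (rule *, simp)
  also have "\<dots> = {path_component_of_set (subtopology X F) x}"
    using x by (intro image_constant[of x]) simp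
  finally show ?thesis
    by (simp add: pi0_incl_def)
qed

lemma end_space_component:
  assumes "a \<in> topspace (end_space X \<epsilon>)" "E \<in> \<epsilon>"
  shows "a E \<in> path_components_of (subtopology X E)"
  using assms by (auto simp: end_space_def topspace_pi0 PiE_iff)

lemma end_space_compat:
  assumes "a \<in> topspace (end_space X \<epsilon>)" "E \<in> \<epsilon>" "F \<in> \<epsilon>" "E \<subseteq> F"
  shows "pi0_incl (subtopology X F) (a E) = a F"
  using assms by (auto simp: end_space_def)

lemma exterior_spaceD:
  assumes "exterior_space X \<epsilon>"
  shows "\<epsilon> \<noteq> {}"
    and "E \<in> \<epsilon> \<Longrightarrow> openin X E"
    and "E \<in> \<epsilon> \<Longrightarrow> F \<in> \<epsilon> \<Longrightarrow> E \<inter> F \<in> \<epsilon>"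
    and "E \<in> \<epsilon> \<Longrightarrow> openin X U \<Longrightarrow> E \<subseteq> U \<Longrightarrow> U \<in> \<epsilon>"
  using assms unfolding exterior_space_def by blast+

lemma C0_openE:
  assumes "C0_open X \<epsilon> W" "a \<in> in0_preimage X \<epsilon> W"
  obtains E G where "E \<in> \<epsilon>" "openin (pi0 (subtopology X E)) G"
    "a \<in> {b \<in> topspace (end_space X \<epsilon>). b E \<in> G}"
    "{b \<in> topspace (end_space X \<epsilon>). b E \<in> G} \<subseteq> in0_preimage X \<epsilon> W"
    "{x \<in> topspace (subtopology X E). path_component_of_set (subtopology X E) x \<in> G}
      \<subseteq> p0_preimage X \<epsilon> W"
  using bspec[OF conjunct2[OF conjunct2[OF conjunct2[OF assms(1)[unfolded C0_open_def]]]] assms(2)]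
  by (elim bexE exE conjE) (rule that)

lemma istopology_C0:
  assumes ext: "exterior_space X \<epsilon>"
  shows "istopology (C0_open X \<epsilon>)"
  unfolding istopology_def
proof (intro conjI allI impI)
  fix S T assume S: "C0_open X \<epsilon> S" and T: "C0_open X \<epsilon> T"
  have p: "p0_preimage X \<epsilon> (S \<inter> T) = p0_preimage X \<epsilon> S \<inter> p0_preimage X \<epsilon> T"
    and i: "in0_preimage X \<epsilon> (S \<inter> T) = in0_preimage X \<epsilon> S \<inter> in0_preimage X \<epsilon> T"
    by (auto simp: p0_preimage_def in0_preimage_def)
  show "C0_open X \<epsilon> (S \<inter> T)"
    unfolding C0_open_def
  proof (intro conjI ballI)
    show "S \<inter> T \<subseteq> pushout_carrier X \<epsilon>"
      using S unfolding C0_open_def by blast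
    show "openin X (p0_preimage X \<epsilon> (S \<inter> T))"
      unfolding p using S T by (intro openin_Int) (simp_all add: C0_open_def)
    show "openin (end_space X \<epsilon>) (in0_preimage X \<epsilon> (S \<inter> T))"
      unfolding i using S T by (intro openin_Int) (simp_all add: C0_open_def)
    fix a assume "a \<in> in0_preimage X \<epsilon> (S \<inter> T)"
    then have aS: "a \<in> in0_preimage X \<epsilon> S" and aT: "a \<in> in0_preimage X \<epsilon> T"
      by (simp_all add: i)
    obtain E1 G1 where 1: "E1 \<in> \<epsilon>" "openin (pi0 (subtopology X E1)) G1"
        "a \<in> {b \<in> topspace (end_space X \<epsilon>). b E1 \<in> G1}"
        "{b \<in> topspace (end_space X \<epsilon>). b E1 \<in> G1} \<subseteq> in0_preimage X \<epsilon> S"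
        "{x \<in> topspace (subtopology X E1). path_component_of_set (subtopology X E1) x \<in> G1}
          \<subseteq> p0_preimage X \<epsilon> S"
      using S aS by (rule C0_openE)
    obtain E2 G2 where 2: "E2 \<in> \<epsilon>" "openin (pi0 (subtopology X E2)) G2"
        "a \<in> {b \<in> topspace (end_space X \<epsilon>). b E2 \<in> G2}"
        "{b \<in> topspace (end_space X \<epsilon>). b E2 \<in> G2} \<subseteq> in0_preimage X \<epsilon> T"
        "{x \<in> topspace (subtopology X E2). path_component_of_set (subtopology X E2) x \<in> G2}
          \<subseteq> p0_preimage X \<epsilon> T"
      using T aT by (rule C0_openE)
    define E where "E = E1 \<inter> E2"
    have E: "E \<in> \<epsilon>" "E \<subseteq> E1" "E \<subseteq> E2"
      using exterior_spaceD(3)[OF ext 1(1) 2(1)] by (simp_all add: E_def)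
    define G where "G = {C \<in> path_components_of (subtopology X E).
       pi0_incl (subtopology X E1) C \<in> G1 \<and> pi0_incl (subtopology X E2) C \<in> G2}"
    define V1 where "V1 =
      {x \<in> topspace (subtopology X E1). path_component_of_set (subtopology X E1) x \<in> G1}"
    define V2 where "V2 =
      {x \<in> topspace (subtopology X E2). path_component_of_set (subtopology X E2) x \<in> G2}"
    have "path_component_of_set (subtopology X E) x \<in> G \<longleftrightarrow>
        path_component_of_set (subtopology X E1) x \<in> G1 \<and>
        path_component_of_set (subtopology X E2) x \<in> G2" if "x \<in> topspace X" "x \<in> E" for x
      using that unfolding G_def
      by (simp add: pi0_incl_eq[OF E(2) that] pi0_incl_eq[OF E(3) that]
          path_component_in_path_components_of)
    then have V: "{x \<in> topspace (subtopology X E). path_component_of_set (subtopology X E) x \<in> G}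
       = E \<inter> (V1 \<inter> V2)"
      using E(2,3) unfolding V1_def V2_def topspace_subtopology by blast
    have "openin (subtopology X E1) V1" "openin (subtopology X E2) V2"
      using 1(2) 2(2) unfolding openin_pi0 V1_def V2_def by blast+
    moreover have "openin X E1" "openin X E2"
      using exterior_spaceD(2)[OF ext] 1(1) 2(1) by blast+
    ultimately have "openin X (V1 \<inter> V2)"
      by (intro openin_Int) (blast intro: openin_trans_full)+
    then have "openin (subtopology X E) (E \<inter> (V1 \<inter> V2))"
      by (rule openin_subtopology_Int2)
    moreover have "G \<subseteq> path_components_of (subtopology X E)"
      unfolding G_def by blast
    ultimately have G: "openin (pi0 (subtopology X E)) G"
      unfolding openin_pi0 V by blast
    have bG: "b E \<in> G \<longleftrightarrow> b E1 \<in> G1 \<and> b E2 \<in> G2" if b: "b \<in> topspace (end_space X \<epsilon>)" for b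
      unfolding G_def using end_space_component[OF b E(1)]
        end_space_compat[OF b E(1) 1(1) E(2)] end_space_compat[OF b E(1) 2(1) E(3)] by simp
    show "\<exists>E\<in>\<epsilon>. \<exists>G. openin (pi0 (subtopology X E)) G \<and>
        a \<in> {b \<in> topspace (end_space X \<epsilon>). b E \<in> G} \<and>
        {b \<in> topspace (end_space X \<epsilon>). b E \<in> G} \<subseteq> in0_preimage X \<epsilon> (S \<inter> T) \<and>
        {x \<in> topspace (subtopology X E). path_component_of_set (subtopology X E) x \<in> G}
          \<subseteq> p0_preimage X \<epsilon> (S \<inter> T)"
    proof (intro bexI[OF _ E(1)] exI conjI)
      show "openin (pi0 (subtopology X E)) G" by (fact G)
      show "a \<in> {b \<in> topspace (end_space X \<epsilon>). b E \<in> G}"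
        using 1(3) 2(3) bG by simp
      show "{b \<in> topspace (end_space X \<epsilon>). b E \<in> G} \<subseteq> in0_preimage X \<epsilon> (S \<inter> T)"
        unfolding i using 1(4) 2(4) bG by blast
      show "{x \<in> topspace (subtopology X E). path_component_of_set (subtopology X E) x \<in> G}
          \<subseteq> p0_preimage X \<epsilon> (S \<inter> T)"
        unfolding p V using 1(5) 2(5) unfolding V1_def V2_def by blast
    qed
  qed
next
  fix K assume K: "\<forall>S\<in>K. C0_open X \<epsilon> S"
  have p: "p0_preimage X \<epsilon> (\<Union>K) = (\<Union>S\<in>K. p0_preimage X \<epsilon> S)"
    and i: "in0_preimage X \<epsilon> (\<Union>K) = (\<Union>S\<in>K. in0_preimage X \<epsilon> S)"
    by (auto simp: p0_preimage_def in0_preimage_def)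
  show "C0_open X \<epsilon> (\<Union>K)"
    unfolding C0_open_def
  proof (intro conjI ballI)
    show "\<Union>K \<subseteq> pushout_carrier X \<epsilon>"
      using K by (auto simp: C0_open_def)
    show "openin X (p0_preimage X \<epsilon> (\<Union>K))"
      unfolding p using K by (auto simp: C0_open_def)
    show "openin (end_space X \<epsilon>) (in0_preimage X \<epsilon> (\<Union>K))"
      unfolding i using K by (auto simp: C0_open_def)
    fix a assume "a \<in> in0_preimage X \<epsilon> (\<Union>K)"
    then obtain S where S: "S \<in> K" "a \<in> in0_preimage X \<epsilon> S"
      unfolding i by auto
    then obtain E G where EG: "E \<in> \<epsilon>" "openin (pi0 (subtopology X E)) G"
        "a \<in> {b \<in> topspace (end_space X \<epsilon>). b E \<in> G}"
        "{b \<in> topspace (end_space X \<epsilon>). b E \<in> G} \<subseteq> in0_preimage X \<epsilon> S"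
        "{x \<in> topspace (subtopology X E). path_component_of_set (subtopology X E) x \<in> G}
          \<subseteq> p0_preimage X \<epsilon> S"
      using K C0_openE[of X \<epsilon> S a] by blast
    have "p0_preimage X \<epsilon> S \<subseteq> p0_preimage X \<epsilon> (\<Union>K)"
         "in0_preimage X \<epsilon> S \<subseteq> in0_preimage X \<epsilon> (\<Union>K)"
      unfolding p i using S by auto
    then show "\<exists>E\<in>\<epsilon>. \<exists>G. openin (pi0 (subtopology X E)) G \<and>
        a \<in> {b \<in> topspace (end_space X \<epsilon>). b E \<in> G} \<and>
        {b \<in> topspace (end_space X \<epsilon>). b E \<in> G} \<subseteq> in0_preimage X \<epsilon> (\<Union>K) \<and>
        {x \<in> topspace (subtopology X E). path_component_of_set (subtopology X E) x \<in> G}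
          \<subseteq> p0_preimage X \<epsilon> (\<Union>K)"
      using EG(2-) by (intro bexI[OF _ EG(1)] exI[of _ G] conjI) (assumption | rule order_trans)+
  qed
qed

lemma openin_C0:
  "exterior_space X \<epsilon> \<Longrightarrow> openin (C0 X \<epsilon>) W \<longleftrightarrow> C0_open X \<epsilon> W"
  unfolding C0_def by (simp add: istopology_C0 topology_inverse')

lemma glue_equiv: "equiv UNIV {(u, v). equivclp (glue X \<epsilon>) u v}"
  by (simp add: equivp_equiv)

lemma pushout_carrier_eq:
  "pushout_carrier X \<epsilon> = p0 X \<epsilon> ` topspace X \<union> in0 X \<epsilon> ` topspace (end_space X \<epsilon>)"
  unfolding pushout_carrier_def quotient_def p0_def in0_def Plus_def by auto

lemma p0_in0: "x \<in> limit_set \<epsilon> \<Longrightarrow> p0 X \<epsilon> x = in0 X \<epsilon> (e0 X \<epsilon> x)"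
  unfolding p0_def in0_def
  by (intro equiv_class_eq[OF glue_equiv]) (auto simp: glue_def intro!: r_into_equivclp)

text \<open>The value of a representative in the push-out: its image in the end space, or the point
  itself if it does not belong to the limit space.\<close>

lemma glue_invariant:
  assumes "equivclp (glue X \<epsilon>) u v"
  defines "h \<equiv> case_sum (\<lambda>x. if x \<in> limit_set \<epsilon> then Inr (e0 X \<epsilon> x) else Inl x) Inr"
  shows "h u = h v"
  using assms(1)
  by (induction rule: equivclp_induct) (auto simp: h_def glue_def split: sum.splits)

lemma p0_eq_iff:
  "p0 X \<epsilon> x = p0 X \<epsilon> y \<longleftrightarrow>
     x = y \<or> x \<in> limit_set \<epsilon> \<and> y \<in> limit_set \<epsilon> \<and> e0 X \<epsilon> x = e0 X \<epsilon> y"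
proof
  assume "p0 X \<epsilon> x = p0 X \<epsilon> y"
  then have "equivclp (glue X \<epsilon>) (Inl x) (Inl y)"
    unfolding p0_def using eq_equiv_class[OF _ glue_equiv] by fastforce
  from glue_invariant[OF this] show
    "x = y \<or> x \<in> limit_set \<epsilon> \<and> y \<in> limit_set \<epsilon> \<and> e0 X \<epsilon> x = e0 X \<epsilon> y"
    by (auto split: if_splits)
qed (auto simp: p0_in0)

lemma p0_eq_in0_iff:
  "p0 X \<epsilon> x = in0 X \<epsilon> a \<longleftrightarrow> x \<in> limit_set \<epsilon> \<and> e0 X \<epsilon> x = a"
proof
  assume "p0 X \<epsilon> x = in0 X \<epsilon> a"
  then have "equivclp (glue X \<epsilon>) (Inl x) (Inr a)"
    unfolding p0_def in0_def using eq_equiv_class[OF _ glue_equiv] by fastforce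
  from glue_invariant[OF this] show "x \<in> limit_set \<epsilon> \<and> e0 X \<epsilon> x = a"
    by (auto split: if_splits)
qed (auto simp: p0_in0)

lemma e0_in_end_space:
  assumes "exterior_space X \<epsilon>" "x \<in> limit_set \<epsilon>"
  shows "e0 X \<epsilon> x \<in> topspace (end_space X \<epsilon>)"
proof -
  have x: "x \<in> E \<and> x \<in> topspace X" if "E \<in> \<epsilon>" for E
  proof
    show "x \<in> E"
      using assms(2) that by (simp add: limit_set_def)
    moreover have "openin X E"
      using exterior_spaceD(2)[OF assms(1)] that .
    ultimately show "x \<in> topspace X"
      using openin_subset by blast
  qed
  then have "path_component_of_set (subtopology X E) x \<in> path_components_of (subtopology X E)"
    if "E \<in> \<epsilon>" for E
    using that by (simp add: path_component_in_path_components_of)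
  moreover have "pi0_incl (subtopology X F) (path_component_of_set (subtopology X E) x)
       = path_component_of_set (subtopology X F) x" if "E \<in> \<epsilon>" "E \<subseteq> F" for E F
    using x that by (intro pi0_incl_eq) simp_all
  ultimately show ?thesis
    by (simp add: end_space_def e0_def topspace_pi0)
qed

lemma W0_preimages:
  assumes "exterior_space X \<epsilon>" "E \<in> \<epsilon>"
  shows "p0_preimage X \<epsilon> (W0 X \<epsilon> E) = E"
    and "in0_preimage X \<epsilon> (W0 X \<epsilon> E) = topspace (end_space X \<epsilon>)"
proof -
  have "E \<subseteq> topspace X" "limit_set \<epsilon> \<subseteq> E"
    using openin_subset[OF exterior_spaceD(2)[OF assms]] assms(2) by (auto simp: limit_set_def)
  then show "p0_preimage X \<epsilon> (W0 X \<epsilon> E) = E"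
    by (auto simp: p0_preimage_def W0_def p0_eq_iff p0_eq_in0_iff)
  show "in0_preimage X \<epsilon> (W0 X \<epsilon> E) = topspace (end_space X \<epsilon>)"
    by (auto simp: in0_preimage_def W0_def)
qed

lemma W0_unique:
  assumes "W \<subseteq> pushout_carrier X \<epsilon>" "in0_preimage X \<epsilon> W = topspace (end_space X \<epsilon>)"
  shows "W = W0 X \<epsilon> (p0_preimage X \<epsilon> W)"
  using assms unfolding pushout_carrier_eq W0_def p0_preimage_def in0_preimage_def by blast

lemma exterior_space_C0:
  assumes ext: "exterior_space X \<epsilon>"
  shows "exterior_space (C0 X \<epsilon>) (C0_externology X \<epsilon>)"
  unfolding exterior_space_def
proof (intro conjI ballI allI impI)
  show "C0_externology X \<epsilon> \<noteq> {}"
    using exterior_spaceD(1)[OF ext] by (auto simp: C0_externology_def)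
next
  fix W assume "W \<in> C0_externology X \<epsilon>"
  then obtain E where E: "E \<in> \<epsilon>" "W = W0 X \<epsilon> E"
    unfolding C0_externology_def by blast
  have EX: "openin X E" "E \<subseteq> topspace X"
    using exterior_spaceD(2)[OF ext E(1)] openin_subset by blast+
  have "C0_open X \<epsilon> W"
    unfolding C0_open_def E(2) W0_preimages[OF ext E(1)]
  proof (intro conjI ballI)
    show "W0 X \<epsilon> E \<subseteq> pushout_carrier X \<epsilon>"
      using EX by (auto simp: pushout_carrier_eq W0_def)
    fix a assume "a \<in> topspace (end_space X \<epsilon>)"
    then show "\<exists>F\<in>\<epsilon>. \<exists>G. openin (pi0 (subtopology X F)) G \<and>
        a \<in> {b \<in> topspace (end_space X \<epsilon>). b F \<in> G} \<and>
        {b \<in> topspace (end_space X \<epsilon>). b F \<in> G} \<subseteq> topspace (end_space X \<epsilon>) \<and>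
        {x \<in> topspace (subtopology X F). path_component_of_set (subtopology X F) x \<in> G} \<subseteq> E"
      using E(1) end_space_component[of a X \<epsilon> E]
      by (intro bexI[of _ E] exI[of _ "path_components_of (subtopology X E)"])
        (auto simp flip: topspace_pi0)
  qed (use EX in auto)
  then show "openin (C0 X \<epsilon>) W"
    by (simp add: openin_C0 ext)
next
  fix V W assume "V \<in> C0_externology X \<epsilon>" "W \<in> C0_externology X \<epsilon>"
  then obtain E F where E: "E \<in> \<epsilon>" "V = W0 X \<epsilon> E" and F: "F \<in> \<epsilon>" "W = W0 X \<epsilon> F"
    unfolding C0_externology_def by blast
  have sub: "E \<subseteq> topspace X" "F \<subseteq> topspace X"
    using exterior_spaceD(2)[OF ext] E(1) F(1) openin_subset by blast+
  have p: "p0_preimage X \<epsilon> (V \<inter> W) = E \<inter> F"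
    using W0_preimages(1)[OF ext E(1)] W0_preimages(1)[OF ext F(1)]
    unfolding p0_preimage_def E(2) F(2) by blast
  have i: "in0_preimage X \<epsilon> (V \<inter> W) = topspace (end_space X \<epsilon>)"
    unfolding E(2) F(2) by (auto simp: in0_preimage_def W0_def)
  have "V \<inter> W \<subseteq> pushout_carrier X \<epsilon>"
    unfolding E(2) F(2) pushout_carrier_eq W0_def using sub by blast
  from W0_unique[OF this i] have "V \<inter> W = W0 X \<epsilon> (E \<inter> F)"
    by (simp add: p)
  then show "V \<inter> W \<in> C0_externology X \<epsilon>"
    using exterior_spaceD(3)[OF ext E(1) F(1)] unfolding C0_externology_def by blast
next
  fix V U assume "V \<in> C0_externology X \<epsilon>" and U: "openin (C0 X \<epsilon>) U \<and> V \<subseteq> U"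
  then obtain E where E: "E \<in> \<epsilon>" "V = W0 X \<epsilon> E"
    unfolding C0_externology_def by blast
  have U': "U \<subseteq> pushout_carrier X \<epsilon>" "openin X (p0_preimage X \<epsilon> U)"
    using U by (auto simp: openin_C0 ext C0_open_def)
  have "E \<subseteq> p0_preimage X \<epsilon> U"
    using W0_preimages(1)[OF ext E(1)] U unfolding p0_preimage_def E(2) by blast
  then have *: "p0_preimage X \<epsilon> U \<in> \<epsilon>"
    using exterior_spaceD(4)[OF ext E(1) U'(2)] by blast
  have "in0_preimage X \<epsilon> U = topspace (end_space X \<epsilon>)"
    using U unfolding E(2) by (auto simp: in0_preimage_def W0_def)
  from W0_unique[OF U'(1) this] * show "U \<in> C0_externology X \<epsilon>"
    unfolding C0_externology_def by blast
qed

lemma topspace_C0: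
  assumes ext: "exterior_space X \<epsilon>"
  shows "topspace (C0 X \<epsilon>) = pushout_carrier X \<epsilon>"
proof (rule subset_antisym)
  have "C0_open X \<epsilon> (topspace (C0 X \<epsilon>))"
    using openin_topspace[of "C0 X \<epsilon>"] by (simp only: openin_C0[OF ext])
  then show "topspace (C0 X \<epsilon>) \<subseteq> pushout_carrier X \<epsilon>"
    unfolding C0_open_def by blast
  obtain E where E: "E \<in> \<epsilon>"
    using exterior_spaceD(1)[OF ext] by blast
  have "topspace X \<in> \<epsilon>"
    using exterior_spaceD(4)[OF ext E openin_topspace]
      openin_subset[OF exterior_spaceD(2)[OF ext E]] by blast
  then have "W0 X \<epsilon> (topspace X) \<in> C0_externology X \<epsilon>"
    unfolding C0_externology_def by blast
  then have "openin (C0 X \<epsilon>) (pushout_carrier X \<epsilon>)"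
    using exterior_spaceD(2)[OF exterior_space_C0[OF ext]]
    unfolding pushout_carrier_eq W0_def by blast
  then show "pushout_carrier X \<epsilon> \<subseteq> topspace (C0 X \<epsilon>)"
    by (rule openin_subset)
qed

end

theory Submission
  imports Defs
begin

text \<open>
  The completion glues the end space to \<open>X\<close> along the map \<^term>\<open>e0 X \<epsilon>\<close> from the limit space,
  which here is \<open>D\<close> itself because \<open>X\<close> is T1.  So \<^term>\<open>p0 X \<epsilon>\<close> is a bijection as soon as
  \<^term>\<open>e0 X \<epsilon>\<close> is one, and continuity of its inverse only has to be checked at the ends.  Both
  reduce to one geometric fact (\<open>small_path_component_of_neighbourhood\<close>): a point \<open>x\<close> of \<open>D\<close> with
  a neighbourhood \<open>U\<close> has path component inside \<open>U\<close> in some sufficiently small neighbourhood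
  \<open>E\<close> of \<open>D\<close>.  Indeed the compact totally disconnected space \<open>D\<close> splits into two disjoint
  closed pieces, one containing \<open>x\<close> and contained in \<open>U\<close>; by normality these
  pieces have disjoint open neighbourhoods, the first one inside \<open>U\<close>, and \<open>E\<close> is their union.

  Taking for \<open>U\<close> the complement of a second point of \<open>D\<close> shows that \<^term>\<open>e0 X \<epsilon>\<close> is injective.
  It is surjective because the closures of the path components that make up an end form a
  directed family of nonempty closed sets in a compact space, and hence have a common point; it
  lies in \<open>D\<close> by regularity, and it represents the end because path components of open sets
  are open in \<open>X\<close> (\<open>e0_surj\<close>).  Finally, the path component \<open>C\<close> of \<open>x\<close> in \<open>E\<close> is an open
  point \<open>G = {C}\<close> of \<open>\<pi>\<^sub>0(E)\<close>, and it is exactly the witness that the topology of the completion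
  asks for at the end of \<open>x\<close> for the image of \<open>U\<close> under \<^term>\<open>p0 X \<epsilon>\<close> to be open
  (\<open>C0_open_p0_image\<close>).
\<close>

section \<open>A criterion for completeness\<close>

lemma limit_set_subset_topspace:
  assumes "exterior_space X \<epsilon>"
  shows "limit_set \<epsilon> \<subseteq> topspace X"
  using exterior_spaceD(1,2)[OF assms] openin_subset unfolding limit_set_def by fastforce

lemma inj_on_p0:
  assumes "inj_on (e0 X \<epsilon>) (limit_set \<epsilon>)"
  shows "inj_on (p0 X \<epsilon>) (topspace X)"
  using assms by (auto simp: inj_on_def p0_eq_iff)

lemma in0_image_eq_p0_image:
  assumes "e0 X \<epsilon> ` limit_set \<epsilon> = topspace (end_space X \<epsilon>)"
  shows "in0 X \<epsilon> ` topspace (end_space X \<epsilon>) = p0 X \<epsilon> ` limit_set \<epsilon>"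
  unfolding assms[symmetric] image_image by (rule image_cong) (simp_all add: p0_in0)

lemma exterior_map_p0:
  assumes ext: "exterior_space X \<epsilon>"
  shows "exterior_map X \<epsilon> (C0 X \<epsilon>) (C0_externology X \<epsilon>) (p0 X \<epsilon>)"
  unfolding exterior_map_def
proof (intro conjI ballI)
  show "continuous_map X (C0 X \<epsilon>) (p0 X \<epsilon>)"
    unfolding continuous_map_def
    by (auto simp: topspace_C0[OF ext] openin_C0[OF ext] pushout_carrier_eq C0_open_def
        p0_preimage_def)
  fix W assume "W \<in> C0_externology X \<epsilon>"
  then obtain E where "E \<in> \<epsilon>" "W = W0 X \<epsilon> E"
    unfolding C0_externology_def by blast
  then show "{x \<in> topspace X. p0 X \<epsilon> x \<in> W} \<in> \<epsilon>"
    using W0_preimages(1)[OF ext] unfolding p0_preimage_def by metis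
qed (use ext exterior_space_C0 in blast)+

lemma openin_end_space_cylinder:
  assumes "E \<in> \<epsilon>" "openin (pi0 (subtopology X E)) G"
  shows "openin (end_space X \<epsilon>) {b \<in> topspace (end_space X \<epsilon>). b E \<in> G}"
proof -
  have "continuous_map (end_space X \<epsilon>) (pi0 (subtopology X E)) (\<lambda>b. b E)"
    unfolding end_space_def using assms(1)
    by (intro continuous_map_from_subtopology continuous_map_product_projection)
  then show ?thesis
    using assms(2) by (rule openin_continuous_map_preimage)
qed

lemma openin_pi0_singleton:
  assumes "x \<in> topspace Y" "openin Y (path_component_of_set Y x)"
  shows "openin (pi0 Y) {path_component_of_set Y x}"
proof -
  have "{y \<in> topspace Y. path_component_of_set Y y \<in> {path_component_of_set Y x}}
      = path_component_of_set Y x"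
    using path_component_of_equiv[of Y] path_component_in_topspace[of Y]
    by (auto simp: path_component_of_refl)
  then show ?thesis
    using assms by (simp add: openin_pi0 path_component_in_path_components_of)
qed

text \<open>
  Since \<^term>\<open>e0 X \<epsilon>\<close> is bijective, so is \<^term>\<open>p0 X \<epsilon>\<close>, and the ends in the image of \<open>U\<close> are the
  ends of the limit points in \<open>U\<close>.  If \<open>x\<close> is such a limit point and \<open>C \<subseteq> U\<close> its path
  component in \<open>E\<close>, then an end whose \<open>E\<close>-coordinate is \<open>C\<close> comes from a limit point in \<open>C\<close>;
  so the basic set given by the open point \<open>C\<close> of \<open>\<pi>\<^sub>0(E)\<close> stays in the image of \<open>U\<close>.
\<close>

lemma C0_open_p0_image:
  assumes ext: "exterior_space X \<epsilon>"
    and inj: "inj_on (e0 X \<epsilon>) (limit_set \<epsilon>)"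
    and surj: "e0 X \<epsilon> ` limit_set \<epsilon> = topspace (end_space X \<epsilon>)"
    and small: "\<And>x U. \<lbrakk>x \<in> limit_set \<epsilon>; openin X U; x \<in> U\<rbrakk> \<Longrightarrow>
       \<exists>E\<in>\<epsilon>. openin X (path_component_of_set (subtopology X E) x) \<and>
             path_component_of_set (subtopology X E) x \<subseteq> U"
    and U: "openin X U"
  shows "C0_open X \<epsilon> (p0 X \<epsilon> ` U)"
proof -
  let ?W = "p0 X \<epsilon> ` U"
  have UX: "U \<subseteq> topspace X"
    using U by (rule openin_subset)
  have pW: "p0_preimage X \<epsilon> ?W = U"
    using inj_on_p0[OF inj] UX unfolding p0_preimage_def inj_on_def by blast
  have iW: "in0_preimage X \<epsilon> ?W = e0 X \<epsilon> ` (limit_set \<epsilon> \<inter> U)"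
  proof (intro subset_antisym subsetI)
    fix a assume "a \<in> in0_preimage X \<epsilon> ?W"
    then obtain x where "x \<in> U" "p0 X \<epsilon> x = in0 X \<epsilon> a"
      unfolding in0_preimage_def by auto
    then show "a \<in> e0 X \<epsilon> ` (limit_set \<epsilon> \<inter> U)"
      by (auto simp: p0_eq_in0_iff)
  next
    fix a assume "a \<in> e0 X \<epsilon> ` (limit_set \<epsilon> \<inter> U)"
    then show "a \<in> in0_preimage X \<epsilon> ?W"
      using e0_in_end_space[OF ext] by (auto simp: in0_preimage_def simp flip: p0_in0)
  qed
  have nbhd: "\<exists>E\<in>\<epsilon>. \<exists>G. openin (pi0 (subtopology X E)) G \<and>
        a \<in> {b \<in> topspace (end_space X \<epsilon>). b E \<in> G} \<and>
        {b \<in> topspace (end_space X \<epsilon>). b E \<in> G} \<subseteq> in0_preimage X \<epsilon> ?W \<and>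
        {x \<in> topspace (subtopology X E). path_component_of_set (subtopology X E) x \<in> G}
          \<subseteq> p0_preimage X \<epsilon> ?W"
    if a: "a \<in> in0_preimage X \<epsilon> ?W" for a
  proof -
    obtain x where x: "x \<in> limit_set \<epsilon>" "x \<in> U" "a = e0 X \<epsilon> x"
      using a unfolding iW by blast
    obtain E where E: "E \<in> \<epsilon>" and
      opn: "openin X (path_component_of_set (subtopology X E) x)" and
      sub: "path_component_of_set (subtopology X E) x \<subseteq> U"
      using small[OF x(1) U x(2)] by blast
    let ?C = "path_component_of_set (subtopology X E)"
    have limE: "y \<in> topspace (subtopology X E)" if "y \<in> limit_set \<epsilon>" for y
      using that E limit_set_subset_topspace[OF ext] by (auto simp: limit_set_def)
    have "openin (subtopology X E) (?C x)"
      using opn path_component_of_subset_topspace[of "subtopology X E" x]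
      by (intro subset_openin_subtopology) auto
    then have G: "openin (pi0 (subtopology X E)) {?C x}"
      by (intro openin_pi0_singleton limE x(1))
    have sameC: "y \<in> U" if "y \<in> topspace (subtopology X E)" "?C y = ?C x" for y
    proof -
      have "y \<in> ?C y"
        using that(1) by (simp add: path_component_of_refl)
      then show ?thesis
        using sub that(2) by blast
    qed
    have "b \<in> in0_preimage X \<epsilon> ?W" if b: "b \<in> topspace (end_space X \<epsilon>)" "b E = ?C x" for b
    proof -
      obtain y where y: "y \<in> limit_set \<epsilon>" "b = e0 X \<epsilon> y"
        using b(1) surj by blast
      then have "?C y = ?C x"
        using b(2) E by (simp add: e0_def)
      then show ?thesis
        unfolding iW using y sameC limE by blast
    qed
    moreover have "a \<in> topspace (end_space X \<epsilon>)" "a E = ?C x"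
      using e0_in_end_space[OF ext x(1)] x(3) E by (simp_all add: e0_def)
    ultimately show ?thesis
      using sameC unfolding pW
      by (intro bexI[OF _ E] exI[of _ "{?C x}"] conjI G) auto
  qed
  show ?thesis
    unfolding C0_open_def
  proof (intro conjI ballI)
    show "?W \<subseteq> pushout_carrier X \<epsilon>"
      using UX unfolding pushout_carrier_eq by blast
    show "openin X (p0_preimage X \<epsilon> ?W)"
      using U by (simp add: pW)
    \<comment> \<open>The cylinders over open sets of \<open>\<pi>\<^sub>0(E)\<close> found above are open in the end space.\<close>
    show "openin (end_space X \<epsilon>) (in0_preimage X \<epsilon> ?W)"
      by (subst openin_subopen) (meson nbhd openin_end_space_cylinder)
  qed (rule nbhd)
qed

lemma C0_completeI:
  assumes ext: "exterior_space X \<epsilon>"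
    and inj: "inj_on (e0 X \<epsilon>) (limit_set \<epsilon>)"
    and surj: "e0 X \<epsilon> ` limit_set \<epsilon> = topspace (end_space X \<epsilon>)"
    and small: "\<And>x U. \<lbrakk>x \<in> limit_set \<epsilon>; openin X U; x \<in> U\<rbrakk> \<Longrightarrow>
       \<exists>E\<in>\<epsilon>. openin X (path_component_of_set (subtopology X E) x) \<and>
             path_component_of_set (subtopology X E) x \<subseteq> U"
  shows "C0_complete X \<epsilon>"
proof -
  define g where "g = the_inv_into (topspace X) (p0 X \<epsilon>)"
  have top: "topspace (C0 X \<epsilon>) = p0 X \<epsilon> ` topspace X"
    unfolding topspace_C0[OF ext] pushout_carrier_eq in0_image_eq_p0_image[OF surj]
    using limit_set_subset_topspace[OF ext] by blast
  have gp: "g (p0 X \<epsilon> x) = x" if "x \<in> topspace X" for x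
    unfolding g_def using that by (rule the_inv_into_f_f[OF inj_on_p0[OF inj]])
  have vimage_g: "{y \<in> topspace (C0 X \<epsilon>). g y \<in> U} = p0 X \<epsilon> ` U" if "U \<subseteq> topspace X" for U
    using that unfolding top by (auto simp: gp)
  have "continuous_map (C0 X \<epsilon>) X g"
    unfolding continuous_map_def
  proof (intro conjI allI impI)
    show "g \<in> topspace (C0 X \<epsilon>) \<rightarrow> topspace X"
      by (auto simp: top gp)
    fix U assume "openin X U"
    then show "openin (C0 X \<epsilon>) {y \<in> topspace (C0 X \<epsilon>). g y \<in> U}"
      using C0_open_p0_image[OF ext inj surj small]
      by (simp add: vimage_g openin_subset openin_C0[OF ext])
  qed
  moreover have "{y \<in> topspace (C0 X \<epsilon>). g y \<in> E} \<in> C0_externology X \<epsilon>" if E: "E \<in> \<epsilon>" for E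
  proof -
    have "limit_set \<epsilon> \<subseteq> E"
      using E by (auto simp: limit_set_def)
    then have "W0 X \<epsilon> E = p0 X \<epsilon> ` E"
      unfolding W0_def in0_image_eq_p0_image[OF surj] by blast
    then show ?thesis
      using E vimage_g[OF openin_subset[OF exterior_spaceD(2)[OF ext E]]]
      by (auto simp: C0_externology_def)
  qed
  ultimately have "exterior_map (C0 X \<epsilon>) (C0_externology X \<epsilon>) X \<epsilon> g"
    using ext exterior_space_C0[OF ext] by (simp add: exterior_map_def)
  then show ?thesis
    unfolding C0_complete_def exterior_isomorphism_def
    using exterior_map_p0[OF ext] gp by (intro conjI exI[of _ g]) (auto simp: top)
qed

section \<open>Neighbourhoods of a closed set as an externology\<close>

lemma exterior_space_neighbourhoods:
  assumes "D \<subseteq> topspace X"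
  shows "exterior_space X {U. D \<subseteq> U \<and> openin X U}"
  using assms unfolding exterior_space_def by auto

lemma limit_set_neighbourhoods:
  assumes "t1_space X" "D \<subseteq> topspace X"
  shows "limit_set {U. D \<subseteq> U \<and> openin X U} = D"
proof
  show "limit_set {U. D \<subseteq> U \<and> openin X U} \<subseteq> D"
  proof
    fix x assume x: "x \<in> limit_set {U. D \<subseteq> U \<and> openin X U}"
    show "x \<in> D"
    proof (rule ccontr)
      assume "x \<notin> D"
      then have "D \<subseteq> topspace X - {x}" "openin X (topspace X - {x})"
        using assms by (auto simp: t1_space_openin_delete_alt)
      then show False
        using x unfolding limit_set_def by blast
    qed
  qed
qed (auto simp: limit_set_def)

lemma small_path_component_of_neighbourhood:
  assumes "compact_space X" "Hausdorff_space X" "closedin X D"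
    and td: "totally_disconnected_space (subtopology X D)"
    and "x \<in> D" "openin X U" "x \<in> U"
  obtains E where "openin X E" "D \<subseteq> E" "path_component_of_set (subtopology X E) x \<subseteq> U"
proof -
  have D: "compact_space (subtopology X D)" "Hausdorff_space (subtopology X D)"
    using assms by (simp_all add: closedin_compact_space compact_space_subtopology
        Hausdorff_space_subtopology)
  have DX: "D \<subseteq> topspace X"
    using assms(3) by (rule closedin_subset)
  \<comment> \<open>In a compact Hausdorff space, closed sets that no connected set meets both of are separated
    by a clopen partition; connected subsets of \<open>D\<close> have at most one point.\<close>
  have "separated_between (subtopology X D) {x} (D - U)"
  proof (rule cut_wire_fence_theorem[OF D])
    show "closedin (subtopology X D) {x}"
      using D(2) DX assms(5) by (intro closedin_Hausdorff_singleton) auto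
    show "closedin (subtopology X D) (D - U)"
      using assms(3,6) by (simp add: closedin_closed_subtopology closedin_diff)
    fix C assume "connectedin (subtopology X D) C"
    then obtain z where "C \<subseteq> {z}"
      using td unfolding totally_disconnected_space_def by blast
    then show "disjnt C {x} \<or> disjnt C (D - U)"
      using assms(7) by (auto simp: disjnt_def)
  qed
  then obtain A B where AB: "closedin (subtopology X D) A" "closedin (subtopology X D) B"
      "A \<union> B = topspace (subtopology X D)" "disjnt A B" "{x} \<subseteq> A" "D - U \<subseteq> B"
    unfolding separated_between_alt by blast
  have "normal_space X"
    using assms(1,2) compact_Hausdorff_or_regular_imp_normal_space by blast
  moreover have "closedin X A" "closedin X B"
    using AB assms(3) by (auto intro: closedin_trans_full)
  ultimately obtain V V' where V: "openin X V" "openin X V'" "A \<subseteq> V" "B \<subseteq> V'" "disjnt V V'"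
    using AB(4) by (meson normal_space_def)
  let ?E = "(V \<inter> U) \<union> V'"
  show ?thesis
  proof
    show "openin X ?E"
      using V assms(6) by blast
    have "A \<subseteq> V \<inter> U \<union> (B \<union> (D - U))"
      using AB(3) V(3) by auto
    moreover have "D \<subseteq> A \<union> B"
      using AB(3) DX by auto
    ultimately show "D \<subseteq> ?E"
      using AB(6) V(4) by blast
    have "path_component_of_set (subtopology X ?E) x \<subseteq> V \<inter> U"
    proof (rule connectedin_subset_separated_union[THEN disjE])
      show "connectedin X (path_component_of_set (subtopology X ?E) x)"
        by (meson connectedin_subtopology path_connectedin_imp_connectedin
            path_connectedin_path_component_of)
      show "separatedin X (V \<inter> U) V'"
        using V assms(6) by (subst separatedin_open_sets) (auto simp: disjnt_def)
      show "path_component_of_set (subtopology X ?E) x \<subseteq> ?E"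
        using path_component_of_subset_topspace[of "subtopology X ?E" x] by auto
    next
      assume "path_component_of_set (subtopology X ?E) x \<subseteq> V'"
      moreover have x: "x \<in> V" "x \<in> V \<inter> U" "x \<in> topspace X"
        using AB V assms by (auto dest: openin_subset)
      then have "x \<in> path_component_of_set (subtopology X ?E) x"
        by (simp add: path_component_of_refl)
      ultimately have False
        using x V(5) by (auto simp: disjnt_def)
      then show ?thesis ..
    qed
    then show "path_component_of_set (subtopology X ?E) x \<subseteq> U"
      by blast
  qed
qed

lemma end_space_mono:
  assumes a: "a \<in> topspace (end_space X \<epsilon>)" and "E \<in> \<epsilon>" "F \<in> \<epsilon>" "E \<subseteq> F"
  shows "a E \<subseteq> a F"
proof -
  obtain x where x: "x \<in> topspace (subtopology X E)"
      "a E = path_component_of_set (subtopology X E) x"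
    using end_space_component[OF a assms(2)] unfolding path_components_of_def by blast
  then have "a F = path_component_of_set (subtopology X F) x"
    using pi0_incl_eq[OF assms(4), of x X] end_space_compat[OF a assms(2-4)] by simp
  then show ?thesis
    using x(2) path_component_of_mono[OF _ assms(4)] by auto
qed

lemma end_space_cluster_point:
  assumes "exterior_space X \<epsilon>" "compact_space X" and a: "a \<in> topspace (end_space X \<epsilon>)"
  obtains x where "\<And>E. E \<in> \<epsilon> \<Longrightarrow> x \<in> X closure_of (a E)"
proof -
  \<comment> \<open>The family is directed: the coordinate of an end at \<open>F\<close> lies in all those at larger sets.\<close>
  have lower: "\<exists>F\<in>\<epsilon>. \<forall>E\<in>K. F \<subseteq> E" if "finite K" "K \<subseteq> \<epsilon>" for K
    using that
  proof (induction K)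
    case empty
    then show ?case
      using exterior_spaceD(1)[OF assms(1)] by blast
  next
    case (insert E K)
    then obtain F where "F \<in> \<epsilon>" "\<forall>E\<in>K. F \<subseteq> E" by auto
    then show ?case
      using insert.prems exterior_spaceD(3)[OF assms(1), of E F]
      by (intro bexI[of _ "E \<inter> F"]) auto
  qed
  have "\<Inter>\<F> \<noteq> {}" if \<F>: "finite \<F>" "\<F> \<subseteq> (\<lambda>E. X closure_of (a E)) ` \<epsilon>" for \<F>
  proof -
    obtain K where K: "K \<subseteq> \<epsilon>" "finite K" "\<F> = (\<lambda>E. X closure_of (a E)) ` K"
      using finite_subset_image[OF \<F>] by blast
    obtain F where F: "F \<in> \<epsilon>" "\<forall>E\<in>K. F \<subseteq> E"
      using lower K by blast
    have "a F \<subseteq> \<Inter>\<F>"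
    proof -
      have "a F \<subseteq> X closure_of (a E)" if "E \<in> K" for E
      proof -
        have "a F \<subseteq> topspace X"
          using path_components_of_subset[OF end_space_component[OF a F(1)]] by simp
        moreover have "a F \<subseteq> a E"
          using that F K(1) by (intro end_space_mono[OF a]) auto
        ultimately show ?thesis
          using closure_of_mono[of "a F" "a E" X] closure_of_subset[of "a F" X] by blast
      qed
      then show ?thesis
        unfolding K(3) by blast
    qed
    moreover have "a F \<noteq> {}"
      using end_space_component[OF a F(1)] nonempty_path_components_of by blast
    ultimately show ?thesis by blast
  qed
  then have "\<Inter>((\<lambda>E. X closure_of (a E)) ` \<epsilon>) \<noteq> {}"
    using assms(2) by (simp add: compact_space_fip)
  then show ?thesis
    using that by blast
qed

text \<open>
  A cluster point of an end lies in \<open>D\<close>, since by regularity any other point has a neighbourhood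
  missing some open \<open>E \<supseteq> D\<close>.  For every \<open>E\<close>, its path component in \<open>E\<close> is a neighbourhood of it
  and thus meets the path component chosen by the end, so both agree.
\<close>

lemma e0_surj:
  fixes X :: "'a topology" and D :: "'a set"
  defines "\<epsilon> \<equiv> {U. D \<subseteq> U \<and> openin X U}"
  assumes lpc: "locally_path_connected_space X"
    and "compact_space X" "Hausdorff_space X" "closedin X D"
  shows "e0 X \<epsilon> ` D = topspace (end_space X \<epsilon>)"
proof -
  have DX: "D \<subseteq> topspace X"
    using assms(5) by (rule closedin_subset)
  have ext: "exterior_space X \<epsilon>"
    unfolding \<epsilon>_def by (rule exterior_space_neighbourhoods[OF DX])
  have "e0 X \<epsilon> ` D \<subseteq> topspace (end_space X \<epsilon>)"
    using e0_in_end_space[OF ext] by (auto simp: limit_set_def \<epsilon>_def)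
  moreover have "a \<in> e0 X \<epsilon> ` D" if a: "a \<in> topspace (end_space X \<epsilon>)" for a
  proof -
    obtain x where x: "\<And>E. E \<in> \<epsilon> \<Longrightarrow> x \<in> X closure_of (a E)"
      using end_space_cluster_point[OF ext assms(3) a] by blast
    have aE: "a E \<subseteq> E" if "E \<in> \<epsilon>" for E
      using path_components_of_subset[OF end_space_component[OF a that]] by simp
    have xD: "x \<in> D"
    proof (rule ccontr)
      assume "x \<notin> D"
      moreover have "topspace X \<in> \<epsilon>"
        using DX by (simp add: \<epsilon>_def)
      then have "x \<in> topspace X"
        using x in_closure_of by fastforce
      ultimately obtain U V where UV: "openin X U" "openin X V" "x \<in> U" "D \<subseteq> V" "disjnt U V"
        using compact_Hausdorff_imp_regular_space[OF assms(3,4)] assms(5)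
        unfolding regular_space_def by (meson DiffI)
      then have "V \<in> \<epsilon>"
        by (simp add: \<epsilon>_def)
      then show False
        using x[of V] aE[of V] UV unfolding in_closure_of disjnt_def by blast
    qed
    have "a E = path_component_of_set (subtopology X E) x" if E: "E \<in> \<epsilon>" for E
    proof -
      let ?C = "path_component_of_set (subtopology X E) x"
      have "x \<in> topspace (subtopology X E)"
        using E xD DX by (auto simp: \<epsilon>_def)
      then have C: "?C \<in> path_components_of (subtopology X E)" "x \<in> ?C"
        by (simp_all add: path_component_in_path_components_of path_component_of_refl)
      then have "openin X ?C"
        using lpc E unfolding locally_path_connected_space_open_path_components \<epsilon>_def by blast
      then have "a E \<inter> ?C \<noteq> {}"
        using x[OF E] C(2) unfolding in_closure_of by blast
      then show ?thesis
        using path_components_of_overlap[OF end_space_component[OF a E] C(1)] by blast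
    qed
    moreover have "a \<in> extensional \<epsilon>"
      using a by (auto simp: end_space_def PiE_iff)
    ultimately have "a = e0 X \<epsilon> x"
      by (intro extensionalityI[where A = \<epsilon>]) (auto simp: e0_def)
    then show ?thesis
      using xD by blast
  qed
  ultimately show ?thesis by blast
qed

theorem theorem3p5:
  fixes X :: "'a topology" and D :: "'a set"
  assumes "locally_path_connected_space X"
    and "compact_space X"
    and "Hausdorff_space X"
    and "closedin X D"
    and "totally_disconnected_space (subtopology X D)"
  shows "C0_complete X {U. D \<subseteq> U \<and> openin X U}"
proof (rule C0_completeI)
  let ?\<epsilon> = "{U. D \<subseteq> U \<and> openin X U}"
  have DX: "D \<subseteq> topspace X"
    using assms(4) by (rule closedin_subset)
  show ext: "exterior_space X ?\<epsilon>"
    using DX by (rule exterior_space_neighbourhoods)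
  have t1: "t1_space X"
    using assms(3) by (rule Hausdorff_imp_t1_space)
  have lim: "limit_set ?\<epsilon> = D"
    using t1 DX by (rule limit_set_neighbourhoods)
  show "e0 X ?\<epsilon> ` limit_set ?\<epsilon> = topspace (end_space X ?\<epsilon>)"
    unfolding lim using assms(1-4) by (rule e0_surj)
  show small: "\<exists>E\<in>?\<epsilon>. openin X (path_component_of_set (subtopology X E) x) \<and>
      path_component_of_set (subtopology X E) x \<subseteq> U"
    if xU: "x \<in> limit_set ?\<epsilon>" "openin X U" "x \<in> U" for x U
  proof -
    have "x \<in> D"
      using xU(1) unfolding lim .
    then obtain E where E: "openin X E" "D \<subseteq> E" "path_component_of_set (subtopology X E) x \<subseteq> U"
      using xU(2,3) by (rule small_path_component_of_neighbourhood[OF assms(2-5)])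
    have "x \<in> topspace (subtopology X E)"
      using \<open>x \<in> D\<close> DX E by auto
    then have "openin X (path_component_of_set (subtopology X E) x)"
      using assms(1) E(1) path_component_in_path_components_of[of "subtopology X E" x]
      unfolding locally_path_connected_space_open_path_components by blast
    then show ?thesis
      using E by blast
  qed
  show "inj_on (e0 X ?\<epsilon>) (limit_set ?\<epsilon>)"
  proof (rule inj_onI, rule ccontr)
    fix x y assume xy: "x \<in> limit_set ?\<epsilon>" "y \<in> limit_set ?\<epsilon>" "e0 X ?\<epsilon> x = e0 X ?\<epsilon> y" "x \<noteq> y"
    have "openin X (topspace X - {y})"
      using t1 by (simp add: t1_space_openin_delete_alt)
    moreover have "x \<in> topspace X - {y}"
      using xy lim DX by auto
    ultimately obtain E where E: "E \<in> ?\<epsilon>"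
        "path_component_of_set (subtopology X E) x \<subseteq> topspace X - {y}"
      using small[OF xy(1)] by blast
    have "path_component_of_set (subtopology X E) x = path_component_of_set (subtopology X E) y"
      using fun_cong[OF xy(3), of E] E(1) by (simp add: e0_def)
    moreover have "y \<in> path_component_of_set (subtopology X E) y"
      using xy(2) lim DX E(1) by (auto simp: path_component_of_refl)
    ultimately show False
      using E(2) by blast
  qed
qed

end
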